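(* Let $q\ge 0$ be an integer, let $G=(V,E)$ be a connected graph whose vertices in $B\subseteq V$ are coloured and whose vertices in $V\setminus B$ are uncoloured, and let $C(G)$ be the bipartite contraction of $G$ (with its induced colouring). If there is a $\mathrm{CCR}_q$ move on $C(G)$ (as opposed to an ordinary application of the CCR) which permits at least one new vertex of $C(G)$ to be forced (whatever the oracle's response), then there exists a matching of size $q+1$ in $C(G)$.
   Context: Graphs are finite, simple and undirected. Colour change rule (CCR): in a graph some of whose vertices are coloured, if a coloured vertex has exactly one uncoloured neighbour, then that neighbour may become coloured (it is "forced"). $\mathrm{CCR}_q$ move on a graph $H$ with coloured set $B_H$ ($q\ge 0$ an integer): let $W_1,\dots,W_k$ be the vertex sets of the connected components of $H[V(H)\setminus B_H]$. If $k\ge q+1$, the player selects at least $q+1$ of the $W_i$'s and announces them to an oracle; the oracle returns a nonempty subset $\{W_{i_1},\dots,W_{i_\ell}\}$ of the selected components; the player may then apply the CCR in the induced subgraph $H[B_H\cup W_{i_1}\cup\dots\cup W_{i_\ell}]$. A $\mathrm{CCR}_q$ move (a selection of at least $q+1$ components) "permits at least one new vertex to be forced" if for every nonempty subset the oracle may return, the CCR can force at least one uncoloured vertex in the corresponding induced subgraph. Bipartite contraction $C(G)$: the graph obtained from $G$ by contracting every edge joining two coloured vertices and every edge joining two uncoloured vertices, repeatedly, until all uncoloured vertices are adjacent only to coloured vertices and vice versa. Thus the coloured (resp. uncoloured) vertices of $C(G)$ correspond to the connected components of $G[B]$ (resp. of $G[V\setminus B]$), a coloured and an uncoloured vertex of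 $C(G)$ being adjacent when there is an edge of $G$ between the corresponding components. In $C(G)$ the uncoloured components are single vertices. *)

theory Defs
  imports "Graph_Theory.Digraph_Component"
begin

text \<open>
  A finite simple undirected graph is a \<^locale>\<open>pair_graph\<close>: finite, loop-free, symmetric, with arcs
  given as pairs of vertices. In a symmetric digraph the strongly connected components are the
  connected components, so \<^const>\<open>pre_digraph.sccs_verts\<close> gives their vertex sets.
\<close>

abbreviation component_verts :: "('a, 'b) pre_digraph \<Rightarrow> 'a set set" where
  "component_verts H \<equiv> pre_digraph.sccs_verts H"


section \<open>The colour change rule and its oracle version\<close>

definition ccr_forces :: "('a, 'b) pre_digraph \<Rightarrow> 'a set \<Rightarrow> 'a \<Rightarrow> 'a \<Rightarrow> bool" where
  "ccr_forces H B b w \<longleftrightarrow> b \<in> verts H \<inter> B \<and> {v \<in> verts H - B. b \<rightarrow>\<^bsub>H\<^esub> v} = {w}"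

definition uncoloured_components :: "('a, 'b) pre_digraph \<Rightarrow> 'a set \<Rightarrow> 'a set set" where
  "uncoloured_components H B = component_verts (H \<restriction> (verts H - B))"

definition ccrq_move :: "nat \<Rightarrow> ('a, 'b) pre_digraph \<Rightarrow> 'a set \<Rightarrow> 'a set set \<Rightarrow> bool" where
  "ccrq_move q H B S \<longleftrightarrow> S \<subseteq> uncoloured_components H B \<and> q + 1 \<le> card S"

text \<open>
  \<open>S\<close> is the set of selected components and \<open>R\<close> ranges over the possible answers of the oracle.
  Note that \<open>H \<restriction> X\<close> has vertex set \<open>X\<close> itself, so these definitions are meant for \<open>B \<subseteq> verts H\<close>.
\<close>

definition permits_force :: "('a, 'b) pre_digraph \<Rightarrow> 'a set \<Rightarrow> 'a set set \<Rightarrow> bool" where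
  "permits_force H B S \<longleftrightarrow>
     (\<forall>R. R \<subseteq> S \<and> R \<noteq> {} \<longrightarrow> (\<exists>b w. ccr_forces (H \<restriction> (B \<union> \<Union>R)) B b w))"


section \<open>Matchings\<close>

definition uedges :: "('a, 'b) pre_digraph \<Rightarrow> 'a set set" where
  "uedges H = {{u, v} | u v. u \<rightarrow>\<^bsub>H\<^esub> v}"

definition matching :: "('a, 'b) pre_digraph \<Rightarrow> 'a set set \<Rightarrow> bool" where
  "matching H M \<longleftrightarrow> M \<subseteq> uedges H \<and> pairwise disjnt M"


section \<open>Bipartite contraction\<close>

text \<open>
  The vertices of the contraction are the vertex sets of the components of \<open>G[B]\<close> (coloured) and of
  \<open>G[V - B]\<close> (uncoloured). That this is the graph obtained by repeatedly contracting
  edges with equally coloured ends is shown below in \<open>iterated_contraction_iff\<close>.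
\<close>

definition contraction_coloured :: "'a pair_pre_digraph \<Rightarrow> 'a set \<Rightarrow> 'a set set" where
  "contraction_coloured G B = component_verts (with_proj G \<restriction> B)"

definition contraction_uncoloured :: "'a pair_pre_digraph \<Rightarrow> 'a set \<Rightarrow> 'a set set" where
  "contraction_uncoloured G B = component_verts (with_proj G \<restriction> (pverts G - B))"

definition bipartite_contraction :: "'a pair_pre_digraph \<Rightarrow> 'a set \<Rightarrow> 'a set pair_pre_digraph" where
  "bipartite_contraction G B =
     \<lparr> pverts = contraction_coloured G B \<union> contraction_uncoloured G B,
       parcs = {(X, Y).
         (X \<in> contraction_coloured G B \<and> Y \<in> contraction_uncoloured G B \<or>
          X \<in> contraction_uncoloured G B \<and> Y \<in> contraction_coloured G B) \<and>
         (\<exists>x\<in>X. \<exists>y\<in>Y. (x, y) \<in> parcs G)} \<rparr>"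


subsection \<open>Contracting edge by edge\<close>

text \<open>
  Vertices are represented by the sets of original vertices merged into them; contracting an edge
  replaces its ends by their union and drops the resulting loops and parallel edges.
\<close>

definition merge_ends :: "'a set \<Rightarrow> 'a set \<Rightarrow> 'a set \<Rightarrow> 'a set" where
  "merge_ends X Y Z = (if Z = X \<or> Z = Y then X \<union> Y else Z)"

definition contract_edge ::
    "'a set \<Rightarrow> 'a set \<Rightarrow> 'a set pair_pre_digraph \<Rightarrow> 'a set pair_pre_digraph" where
  "contract_edge X Y H =
     \<lparr> pverts = merge_ends X Y ` pverts H,
       parcs = {(merge_ends X Y U, merge_ends X Y W) | U W. (U, W) \<in> parcs H \<and> merge_ends X Y U \<noteq> merge_ends X Y W} \<rparr>"

definition singleton_graph :: "'a pair_pre_digraph \<Rightarrow> 'a set pair_pre_digraph" where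
  "singleton_graph G =
     \<lparr> pverts = (\<lambda>v. {v}) ` pverts G, parcs = {({u}, {v}) | u v. (u, v) \<in> parcs G} \<rparr>"

definition mono_edge :: "'a set pair_pre_digraph \<Rightarrow> 'a set set \<Rightarrow> 'a set \<Rightarrow> 'a set \<Rightarrow> bool" where
  "mono_edge H C X Y \<longleftrightarrow> (X, Y) \<in> parcs H \<and> (X \<in> C \<longleftrightarrow> Y \<in> C)"

inductive mono_contract ::
    "'a set pair_pre_digraph \<times> 'a set set \<Rightarrow> 'a set pair_pre_digraph \<times> 'a set set \<Rightarrow> bool" where
  "mono_edge H C X Y \<Longrightarrow> mono_contract (H, C) (contract_edge X Y H, merge_ends X Y ` C)"

definition iterated_contraction ::
    "'a pair_pre_digraph \<Rightarrow> 'a set \<Rightarrow> 'a set pair_pre_digraph \<Rightarrow> 'a set set \<Rightarrow> bool" where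
  "iterated_contraction G B H C \<longleftrightarrow>
     mono_contract\<^sup>*\<^sup>* (singleton_graph G, (\<lambda>v. {v}) ` B) (H, C) \<and> (\<nexists>X Y. mono_edge H C X Y)"

locale coloured_graph = pair_graph G for G :: "'a pair_pre_digraph" +
  fixes B :: "'a set"
  assumes B_sub: "B \<subseteq> pverts G"
begin

definition linked :: "'a \<Rightarrow> 'a \<Rightarrow> bool" where
  "linked u v \<longleftrightarrow> (u, v) \<in> {(x, y) \<in> parcs G. x \<in> B \<longleftrightarrow> y \<in> B}\<^sup>*"

lemma linked_refl: "linked u u"
  by (simp add: linked_def)

lemma linked_trans: "linked u v \<Longrightarrow> linked v w \<Longrightarrow> linked u w"
  unfolding linked_def by (rule rtrancl_trans)

lemma linked_sym: "linked u v \<Longrightarrow> linked v u"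
proof -
  have "sym {(x, y) \<in> parcs G. x \<in> B \<longleftrightarrow> y \<in> B}"
    by (auto simp: sym_def intro: arcs_symmetric)
  then have "sym ({(x, y) \<in> parcs G. x \<in> B \<longleftrightarrow> y \<in> B}\<^sup>*)"
    by (rule sym_rtrancl)
  then show "linked u v \<Longrightarrow> linked v u"
    unfolding linked_def by (rule symD)
qed

lemma linked_same: "linked u v \<Longrightarrow> (u \<in> B \<longleftrightarrow> v \<in> B) \<and> (u \<in> pverts G \<longleftrightarrow> v \<in> pverts G)"
  unfolding linked_def by (induction rule: rtrancl_induct) (auto dest: in_arcsD1 in_arcsD2)

lemma reachable_iff_linked:
  assumes "S = B \<or> S = pverts G - B"
  shows "u \<rightarrow>\<^sup>*\<^bsub>with_proj G \<restriction> S\<^esub> v \<longleftrightarrow> u \<in> S \<and> linked u v"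
proof
  assume "u \<rightarrow>\<^sup>*\<^bsub>with_proj G \<restriction> S\<^esub> v"
  then show "u \<in> S \<and> linked u v"
    unfolding reachable_def
  proof (induction rule: rtrancl_on_induct)
    case base
    then show ?case by (simp add: linked_refl)
  next
    case (step v w)
    then have "(v, w) \<in> parcs G" "v \<in> S" "w \<in> S"
      by (auto simp: arcs_ends_conv)
    then have "linked v w" using assms by (auto simp: linked_def)
    with step.IH show ?case using linked_trans by blast
  qed
next
  assume a: "u \<in> S \<and> linked u v"
  from a have "(u, v) \<in> {(x, y) \<in> parcs G. x \<in> B \<longleftrightarrow> y \<in> B}\<^sup>*"
    by (simp add: linked_def)
  then show "u \<rightarrow>\<^sup>*\<^bsub>with_proj G \<restriction> S\<^esub> v"
    unfolding reachable_def
  proof (induction rule: rtrancl_induct)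
    case base
    then show ?case using a by simp
  next
    case (step v w)
    have "v \<in> S" using step.hyps(1) a assms linked_same[of u v] by (auto simp: linked_def)
    moreover have "w \<in> S" using step.hyps(2) \<open>v \<in> S\<close> assms by (auto dest: in_arcsD2)
    ultimately have "(v, w) \<in> arcs_ends (with_proj G \<restriction> S)"
      using step.hyps(2) by (force simp: arcs_ends_conv)
    with step.IH \<open>w \<in> S\<close> show ?case
      by (simp add: rtrancl_on_into_rtrancl_on)
  qed
qed

lemma component_verts_iff:
  assumes "S = B \<or> S = pverts G - B"
  shows "X \<in> component_verts (with_proj G \<restriction> S) \<longleftrightarrow> (\<exists>x\<in>S. X = {v. linked x v})"
proof
  assume X: "X \<in> component_verts (with_proj G \<restriction> S)"
  then obtain x where x: "x \<in> X" by (auto simp: pre_digraph.sccs_verts_def)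
  from X have 1: "\<forall>u\<in>X. \<forall>v\<in>X. u \<in> S \<and> linked u v"
    and 2: "\<forall>u\<in>X. \<forall>v. v \<notin> X \<longrightarrow> \<not> (u \<in> S \<and> linked u v) \<or> \<not> (v \<in> S \<and> linked v u)"
    by (simp_all add: pre_digraph.sccs_verts_def reachable_iff_linked[OF assms])
  have "v \<in> X" if "linked x v" for v
    using 1 2 x that linked_sym[OF that] linked_same[OF that] assms by blast
  with 1 x show "\<exists>x\<in>S. X = {v. linked x v}" by blast
next
  assume "\<exists>x\<in>S. X = {v. linked x v}"
  then obtain x where x: "x \<in> S" "X = {v. linked x v}" by blast
  have S: "v \<in> S" if "linked x v" for v
    using x(1) linked_same[OF that] assms by blast
  have "X \<noteq> {}" "\<forall>u\<in>X. \<forall>v\<in>X. u \<in> S \<and> linked u v"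
    "\<forall>u\<in>X. \<forall>v. v \<notin> X \<longrightarrow> \<not> (u \<in> S \<and> linked u v) \<or> \<not> (v \<in> S \<and> linked v u)"
    unfolding x(2) using S linked_refl linked_trans linked_sym by (blast, blast, blast)
  then show "X \<in> component_verts (with_proj G \<restriction> S)"
    by (simp add: pre_digraph.sccs_verts_def reachable_iff_linked[OF assms])
qed

definition contraction_inv :: "'a set pair_pre_digraph \<Rightarrow> 'a set set \<Rightarrow> bool" where
  "contraction_inv H C \<longleftrightarrow> \<Union>(pverts H) = pverts G \<and> {} \<notin> pverts H \<and> pairwise disjnt (pverts H) \<and>
     C = {X \<in> pverts H. X \<subseteq> B} \<and>
     parcs H = {(X, Y). X \<in> pverts H \<and> Y \<in> pverts H \<and> X \<noteq> Y \<and> (\<exists>x\<in>X. \<exists>y\<in>Y. (x, y) \<in> parcs G)} \<and>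
     (\<forall>X\<in>pverts H. \<forall>u\<in>X. \<forall>v\<in>X. linked u v)"

lemma inv_init: "contraction_inv (singleton_graph G) ((\<lambda>v. {v}) ` B)"
proof -
  have "parcs (singleton_graph G) = {(X, Y). X \<in> (\<lambda>v. {v}) ` pverts G \<and>
      Y \<in> (\<lambda>v. {v}) ` pverts G \<and> X \<noteq> Y \<and> (\<exists>x\<in>X. \<exists>y\<in>Y. (x, y) \<in> parcs G)}"
    unfolding singleton_graph_def by (auto dest: no_loops' in_arcsD1 in_arcsD2)
  moreover have "(\<lambda>v. {v}) ` B = {X \<in> (\<lambda>v. {v}) ` pverts G. X \<subseteq> B}"
    using B_sub by auto
  ultimately show ?thesis
    unfolding contraction_inv_def by (auto simp: singleton_graph_def pairwise_def linked_refl)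
qed

lemma inv_step:
  assumes contraction_inv: "contraction_inv H C" and e: "mono_edge H C X Y"
  shows "contraction_inv (contract_edge X Y H) (merge_ends X Y ` C)"
    and "card (pverts (contract_edge X Y H)) < card (pverts H)"
proof -
  have U: "\<Union>(pverts H) = pverts G" and ne: "{} \<notin> pverts H"
    and dj: "\<And>X Y. X \<in> pverts H \<Longrightarrow> Y \<in> pverts H \<Longrightarrow> X \<noteq> Y \<Longrightarrow> X \<inter> Y = {}"
    and C: "C = {X \<in> pverts H. X \<subseteq> B}"
    and A: "parcs H = {(X, Y). X \<in> pverts H \<and> Y \<in> pverts H \<and> X \<noteq> Y \<and>
              (\<exists>x\<in>X. \<exists>y\<in>Y. (x, y) \<in> parcs G)}"
    and L: "\<And>X u v. X \<in> pverts H \<Longrightarrow> u \<in> X \<Longrightarrow> v \<in> X \<Longrightarrow> linked u v"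
    using contraction_inv by (auto simp: contraction_inv_def pairwise_def disjnt_def)
  have XY: "X \<in> pverts H" "Y \<in> pverts H" "X \<noteq> Y" and same: "X \<subseteq> B \<longleftrightarrow> Y \<subseteq> B"
    using e unfolding mono_edge_def A C by auto
  obtain x y where xy: "x \<in> X" "y \<in> Y" "(x, y) \<in> parcs G"
    using e unfolding mono_edge_def A by auto
  have mono: "u \<in> B \<longleftrightarrow> Z \<subseteq> B" if "Z \<in> pverts H" "u \<in> Z" for Z u
    using that L linked_same by blast
  have "x \<in> B \<longleftrightarrow> y \<in> B" using mono[OF XY(1) xy(1)] mono[OF XY(2) xy(2)] same by simp
  with xy(3) have lxy: "linked x y" by (auto simp: linked_def)
  have mv: "pverts (contract_edge X Y H) = insert (X \<union> Y) (pverts H - {X, Y})"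
    using XY by (auto simp: contract_edge_def merge_ends_def image_iff)
  have fin: "finite (pverts H)"
    using pair_finite_verts U by (metis finite_UnionD)
  have "card (insert (X \<union> Y) (pverts H - {X, Y})) \<le> Suc (card (pverts H - {X, Y}))"
    by (rule card_insert_le_m1) auto
  moreover have "card (pverts H - {X, Y}) = card (pverts H) - 2"
    using XY fin by (subst card_Diff_subset) auto
  moreover have "card {X, Y} \<le> card (pverts H)" using XY fin by (intro card_mono) auto
  ultimately show "card (pverts (contract_edge X Y H)) < card (pverts H)"
    using XY(3) mv by simp
  have L': "linked u v" if "u \<in> X \<union> Y" "v \<in> X \<union> Y" for u v
  proof -
    have "linked w x" if "w \<in> X \<union> Y" for w
      using that L[OF XY(1)] L[OF XY(2)] xy lxy linked_trans linked_sym by blast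
    with that show ?thesis using linked_trans linked_sym by blast
  qed
  have arcs: "parcs (contract_edge X Y H) =
      {(P, Q). P \<in> merge_ends X Y ` pverts H \<and> Q \<in> merge_ends X Y ` pverts H \<and> P \<noteq> Q \<and>
         (\<exists>x\<in>P. \<exists>y\<in>Q. (x, y) \<in> parcs G)}" (is "_ = ?R")
  proof (intro set_eqI iffI)
    fix e assume "e \<in> parcs (contract_edge X Y H)"
    then obtain U W where UW: "e = (merge_ends X Y U, merge_ends X Y W)" "(U, W) \<in> parcs H"
      "merge_ends X Y U \<noteq> merge_ends X Y W"
      by (auto simp: contract_edge_def)
    have "U \<subseteq> merge_ends X Y U" "W \<subseteq> merge_ends X Y W" by (auto simp: merge_ends_def)
    with UW show "e \<in> ?R" unfolding A by blast
  next
    fix e assume "e \<in> ?R"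
    then obtain P Q u w where PQ: "e = (P, Q)" "P \<in> merge_ends X Y ` pverts H"
      "Q \<in> merge_ends X Y ` pverts H" "P \<noteq> Q" "u \<in> P" "w \<in> Q" "(u, w) \<in> parcs G" by blast
    have "\<exists>U \<in> pverts H. P = merge_ends X Y U \<and> u \<in> U"
      using PQ(2,5) XY by (auto simp: merge_ends_def split: if_splits)
    moreover have "\<exists>W \<in> pverts H. Q = merge_ends X Y W \<and> w \<in> W"
      using PQ(3,6) XY by (auto simp: merge_ends_def split: if_splits)
    ultimately obtain U W where "U \<in> pverts H" "P = merge_ends X Y U" "u \<in> U"
      "W \<in> pverts H" "Q = merge_ends X Y W" "w \<in> W" by blast
    moreover from this PQ(4,7) have "(U, W) \<in> parcs H" unfolding A by auto
    ultimately show "e \<in> parcs (contract_edge X Y H)"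
      using PQ(1,4) by (auto simp: contract_edge_def)
  qed
  have "merge_ends X Y ` C = {Z \<in> pverts (contract_edge X Y H). Z \<subseteq> B}"
    unfolding C contract_edge_def using same by (auto simp: merge_ends_def image_iff)
  moreover have "\<Union>(pverts (contract_edge X Y H)) = pverts G"
    unfolding mv using U XY by blast
  moreover have "{} \<notin> pverts (contract_edge X Y H)"
    unfolding mv using ne xy by blast
  moreover have "pairwise disjnt (pverts (contract_edge X Y H))"
    unfolding mv pairwise_def disjnt_def using dj XY by blast
  moreover have "\<forall>Z\<in>pverts (contract_edge X Y H). \<forall>u\<in>Z. \<forall>v\<in>Z. linked u v"
    unfolding mv using L L' by blast
  moreover have "pverts (contract_edge X Y H) = merge_ends X Y ` pverts H"
    by (simp add: contract_edge_def)
  ultimately show "contraction_inv (contract_edge X Y H) (merge_ends X Y ` C)"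
    using arcs unfolding contraction_inv_def by simp
qed

lemma inv_steps:
  assumes "mono_contract\<^sup>*\<^sup>* (H, C) (H', C')" "contraction_inv H C"
  shows "contraction_inv H' C'"
  using assms
proof (induction "(H', C')" arbitrary: H' C' rule: rtranclp_induct)
  case base
  then show ?case by simp
next
  case (step y)
  then show ?case by (cases y) (auto elim!: mono_contract.cases intro: inv_step(1))
qed

lemma inv_final:
  assumes contraction_inv: "contraction_inv H C" and fin: "\<nexists>X Y. mono_edge H C X Y"
  shows "H = bipartite_contraction G B \<and> C = contraction_coloured G B"
proof -
  have U: "\<Union>(pverts H) = pverts G" and ne: "{} \<notin> pverts H"
    and dj: "\<And>X Y. X \<in> pverts H \<Longrightarrow> Y \<in> pverts H \<Longrightarrow> X \<noteq> Y \<Longrightarrow> X \<inter> Y = {}"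
    and C: "C = {X \<in> pverts H. X \<subseteq> B}"
    and A: "parcs H = {(X, Y). X \<in> pverts H \<and> Y \<in> pverts H \<and> X \<noteq> Y \<and>
              (\<exists>x\<in>X. \<exists>y\<in>Y. (x, y) \<in> parcs G)}"
    and L: "\<And>X u v. X \<in> pverts H \<Longrightarrow> u \<in> X \<Longrightarrow> v \<in> X \<Longrightarrow> linked u v"
    using contraction_inv by (auto simp: contraction_inv_def pairwise_def disjnt_def)
  have mono: "u \<in> B \<longleftrightarrow> Z \<subseteq> B" if "Z \<in> pverts H" "u \<in> Z" for Z u
    using that L linked_same by blast
  have closed: "v \<in> X" if "X \<in> pverts H" "u \<in> X" "linked u v" for X u v
    using that(3) unfolding linked_def
  proof (induction rule: rtrancl_induct)
    case base
    then show ?case using that by simp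
  next
    case (step v w)
    from step.hyps(2) have vw: "(v, w) \<in> parcs G" "v \<in> B \<longleftrightarrow> w \<in> B" by auto
    then obtain Y where Y: "Y \<in> pverts H" "w \<in> Y" using U in_arcsD2 by blast
    show ?case
    proof (rule ccontr)
      assume "w \<notin> X"
      then have "X \<noteq> Y" using Y by blast
      then have "mono_edge H C X Y"
        unfolding mono_edge_def A C
        using step.IH that(1) Y vw mono[OF that(1) step.IH] mono[OF Y] by auto
      with fin show False by blast
    qed
  qed
  have cls: "X = {v. linked u v}" if "X \<in> pverts H" "u \<in> X" for X u
    using closed[OF that] L[OF that] by blast
  have V: "X \<in> pverts H \<longleftrightarrow> (\<exists>x\<in>pverts G. X = {v. linked x v})" for X
  proof
    assume "X \<in> pverts H"
    then show "\<exists>x\<in>pverts G. X = {v. linked x v}" using ne U cls by (metis UnionI ex_in_conv)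
  next
    assume "\<exists>x\<in>pverts G. X = {v. linked x v}"
    then obtain x where x: "x \<in> pverts G" "X = {v. linked x v}" by blast
    then obtain Y where "Y \<in> pverts H" "x \<in> Y" using U by blast
    with cls x show "X \<in> pverts H" by blast
  qed
  have lB: "{v. linked x v} \<subseteq> B \<longleftrightarrow> x \<in> B" for x
    using linked_refl linked_same by blast
  have cC: "X \<in> contraction_coloured G B \<longleftrightarrow> X \<in> pverts H \<and> X \<subseteq> B" for X
    unfolding contraction_coloured_def component_verts_iff[OF disjI1[OF refl]] V
    using lB B_sub by blast
  have cU: "X \<in> contraction_uncoloured G B \<longleftrightarrow> X \<in> pverts H \<and> \<not> X \<subseteq> B" for X
    unfolding contraction_uncoloured_def component_verts_iff[OF disjI2[OF refl]] V
    using lB by blast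
  have C_eq: "C = contraction_coloured G B" unfolding C using cC by blast
  have bip: "(X \<subseteq> B) \<noteq> (Y \<subseteq> B)" if "(X, Y) \<in> parcs H" for X Y
    using that fin unfolding mono_edge_def A C by blast
  have "parcs H = parcs (bipartite_contraction G B)"
    unfolding bipartite_contraction_def cC cU using bip by (auto simp: A)
  moreover have "pverts H = pverts (bipartite_contraction G B)"
    unfolding bipartite_contraction_def using cC cU by auto
  ultimately show ?thesis using C_eq by simp
qed

lemma inv_terminates:
  assumes "contraction_inv H C"
  shows "\<exists>H' C'. mono_contract\<^sup>*\<^sup>* (H, C) (H', C') \<and> (\<nexists>X Y. mono_edge H' C' X Y)"
  using assms
proof (induction "card (pverts H)" arbitrary: H C rule: less_induct)
  case less
  show ?case
  proof (cases "\<exists>X Y. mono_edge H C X Y")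
    case True
    then obtain X Y where e: "mono_edge H C X Y" by blast
    from less.hyps[OF inv_step(2,1)[OF less.prems e]] obtain H' C' where
      "mono_contract\<^sup>*\<^sup>* (contract_edge X Y H, merge_ends X Y ` C) (H', C')"
      "\<nexists>X Y. mono_edge H' C' X Y" by blast
    with mono_contract.intros[OF e] show ?thesis by (meson converse_rtranclp_into_rtranclp)
  qed blast
qed

end

lemma iterated_contraction_iff:
  assumes "pair_graph G" "B \<subseteq> pverts G"
  shows "iterated_contraction G B H C \<longleftrightarrow>
           H = bipartite_contraction G B \<and> C = contraction_coloured G B"
proof -
  interpret coloured_graph G B
    using assms by (simp add: coloured_graph_def coloured_graph_axioms_def)
  have only: "H = bipartite_contraction G B \<and> C = contraction_coloured G B"
    if "iterated_contraction G B H C" for H C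
    using that inv_final inv_steps inv_init unfolding iterated_contraction_def by blast
  moreover obtain H' C' where "iterated_contraction G B H' C'"
    using inv_terminates[OF inv_init] unfolding iterated_contraction_def by blast
  ultimately show ?thesis by blast
qed

end

theory Submission
  imports Defs
begin

text \<open>
  Let the oracle return all selected components: some coloured \<open>b\<close> forces some \<open>w\<close>, so \<open>b\<close> has no
  other neighbour in any selected component. Withdraw the component of \<open>w\<close> and repeat. Each later
  force is along an edge to a component still present when \<open>b\<close> was chosen, so it starts from a
  coloured vertex other than \<open>b\<close>. Hence the forcing edges form a matching with one edge per
  selected component.
\<close>

lemma dominates_induce_subgraph_iff:
  "u \<rightarrow>\<^bsub>H \<restriction> X\<^esub> v \<longleftrightarrow> u \<rightarrow>\<^bsub>H\<^esub> v \<and> u \<in> X \<and> v \<in> X"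
  by (auto simp: arcs_ends_conv)

lemma in_verts_if_in_component_verts:
  assumes "X \<in> component_verts H" "x \<in> X"
  shows "x \<in> verts H"
proof -
  \<comment> \<open>A component relates all pairs of its members, so also \<open>x\<close> to
    itself; reachability is reflexive only at vertices.\<close>
  have "x \<rightarrow>\<^sup>*\<^bsub>H\<^esub> x" using assms unfolding pre_digraph.sccs_verts_def by blast
  then show ?thesis unfolding reachable_def by (rule in_rtrancl_on_in_F)
qed

text \<open>A vertex shared by two components is mutually reachable with all of both, so by
  maximality they coincide.\<close>

lemma pairwise_disjnt_component_verts: "pairwise disjnt (component_verts H)"
  unfolding pairwise_def disjnt_def pre_digraph.sccs_verts_def by blast

lemma disjnt_uncoloured_component:
  assumes "X \<in> uncoloured_components H B"
  shows "disjnt X B"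
  using in_verts_if_in_component_verts[OF assms[unfolded uncoloured_components_def]]
  by (auto simp: disjnt_def)

text \<open>The family \<open>S\<close> is general and free of the bound \<open>q\<close>, so that
  the induction can withdraw a member. The form of the edges in \<open>M\<close> records where the
  later forces end.\<close>

lemma matching_if_permits_force:
  assumes "finite S" "pairwise disjnt S" "\<And>X. X \<in> S \<Longrightarrow> disjnt X B" "permits_force H B S"
  shows "\<exists>M. M \<subseteq> {{b, v} | b v. b \<in> B \<and> v \<in> \<Union>S \<and> b \<rightarrow>\<^bsub>H\<^esub> v} \<and> pairwise disjnt M \<and>
           finite M \<and> card M = card S"
  using assms
proof (induction "card S" arbitrary: S)
  case 0
  then show ?case by (intro exI[of _ "{}"]) auto
next
  case (Suc n)
  have SB: "\<Union>S \<inter> B = {}" using Suc.prems(3) by (auto simp: disjnt_def)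
  have "S \<noteq> {}" using Suc.hyps(2) by auto
  then obtain b w where bw: "ccr_forces (H \<restriction> (B \<union> \<Union>S)) B b w"
    using Suc.prems(4) unfolding permits_force_def by blast
  then have b: "b \<in> B" and "{v \<in> \<Union>S - B. b \<rightarrow>\<^bsub>H\<^esub> v} = {w}"
    unfolding ccr_forces_def dominates_induce_subgraph_iff by auto
  \<comment> \<open>\<open>S\<close> avoids \<open>B\<close>, so all of \<open>\<Union>S\<close> is
    uncoloured and \<open>w\<close> is the only neighbour of \<open>b\<close> there.\<close>
  then have N: "v \<in> \<Union>S \<and> b \<rightarrow>\<^bsub>H\<^esub> v \<longleftrightarrow> v = w" for v using SB by blast
  obtain W where W: "W \<in> S" "w \<in> W" using N[of w] by blast
  have "n = card (S - {W})" using Suc.hyps(2) Suc.prems(1) W(1) by simp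
  moreover have "finite (S - {W})" "pairwise disjnt (S - {W})"
    using Suc.prems(1,2) by (auto intro: pairwise_subset)
  \<comment> \<open>An oracle answer drawn from \<open>S - {W}\<close> is also one drawn from
    \<open>S\<close>.\<close>
  moreover have "permits_force H B (S - {W})"
    using Suc.prems(4) unfolding permits_force_def by (meson Diff_subset subset_trans)
  ultimately obtain M where M: "M \<subseteq> {{b, v} | b v. b \<in> B \<and> v \<in> \<Union>(S - {W}) \<and> b \<rightarrow>\<^bsub>H\<^esub> v}"
    "pairwise disjnt M" "finite M" "card M = n"
    using Suc.hyps(1)[of "S - {W}"] Suc.prems(3) by auto
  have w: "w \<notin> \<Union>(S - {W})" using Suc.prems(2) W by (auto simp: pairwise_def disjnt_def)
  have new: "disjnt {b, w} e" if eM: "e \<in> M" for e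
  proof -
    obtain b' v where e: "e = {b', v}" "b' \<in> B" "v \<in> \<Union>(S - {W})" "b' \<rightarrow>\<^bsub>H\<^esub> v"
      using M(1) eM by blast
    then have v: "v \<in> \<Union>S" "v \<noteq> w" using w by auto
    then have "b' \<noteq> b" using N[of v] e(4) by auto
    \<comment> \<open>A coloured end never equals an uncoloured one.\<close>
    moreover have "v \<noteq> b" using SB b v(1) by blast
    moreover have "b' \<noteq> w" using SB e(2) W by blast
    ultimately show ?thesis using e(1) v(2) by auto
  qed
  \<comment> \<open>Otherwise the nonempty \<open>{b, w}\<close> would be disjoint from
    itself.\<close>
  have "{b, w} \<notin> M" using new by fastforce
  then have "card (insert {b, w} M) = card S" using M(3,4) Suc.hyps(2) by simp
  moreover have "pairwise disjnt (insert {b, w} M)"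
    using M(2) new by (auto simp: pairwise_insert intro: disjnt_sym)
  moreover have "M \<subseteq> {{b, v} | b v. b \<in> B \<and> v \<in> \<Union>S \<and> b \<rightarrow>\<^bsub>H\<^esub> v}" using M(1) by blast
  moreover have "{b, w} \<in> {{b, v} | b v. b \<in> B \<and> v \<in> \<Union>S \<and> b \<rightarrow>\<^bsub>H\<^esub> v}" using b N[of w] by blast
  ultimately show ?case using M(3) by (intro exI[of _ "insert {b, w} M"]) simp
qed

lemma matching_if_ccrq_move:
  assumes "ccrq_move q H B S" "permits_force H B S"
  shows "\<exists>M. matching H M \<and> card M = q + 1"
proof -
  have S: "S \<subseteq> uncoloured_components H B" "q + 1 \<le> card S"
    using assms(1) by (auto simp: ccrq_move_def)
  \<comment> \<open>An infinite set has \<open>card\<close> 0, which is below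
    \<open>q + 1\<close>.\<close>
  then have "finite S" by (intro card_ge_0_finite) simp
  moreover have "pairwise disjnt S"
    using pairwise_disjnt_component_verts S(1) unfolding uncoloured_components_def
    by (rule pairwise_subset)
  ultimately obtain M where M: "M \<subseteq> {{b, v} | b v. b \<in> B \<and> v \<in> \<Union>S \<and> b \<rightarrow>\<^bsub>H\<^esub> v}"
    "pairwise disjnt M" "card M = card S"
    using matching_if_permits_force[OF _ _ _ assms(2)] disjnt_uncoloured_component S(1)
    by (meson subsetD)
  \<comment> \<open>More than \<open>q + 1\<close> components may be selected; a subset of a
    matching is still a matching.\<close>
  obtain M' where M': "M' \<subseteq> M" "card M' = q + 1"
    using S(2) M(3) obtain_subset_with_card_n[of "q + 1" M] by metis
  have "M' \<subseteq> uedges H" using M(1) M'(1) unfolding uedges_def by blast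
  then show ?thesis using M' pairwise_subset[OF M(2)] unfolding matching_def by blast
qed

theorem theorem2p3:
  fixes q :: nat and G :: "'a pair_pre_digraph" and B :: "'a set"
  assumes "pair_graph G" and "connected (with_proj G)" and "B \<subseteq> pverts G"
    and "\<exists>S. ccrq_move q (with_proj (bipartite_contraction G B)) (contraction_coloured G B) S \<and>
             permits_force (with_proj (bipartite_contraction G B)) (contraction_coloured G B) S"
  shows "\<exists>M. matching (with_proj (bipartite_contraction G B)) M \<and> card M = q + 1"
  using assms(4) matching_if_ccrq_move by blast

end
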